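(* Let $G_7$ be the graph with vertex set $\{x_1,\dots,x_8\}$ and edge set $\{x_1x_2, x_1x_3, x_2x_3, x_4x_5, x_4x_6, x_5x_6, x_1x_4, x_2x_5, x_3x_6, x_1x_7, x_5x_7, x_2x_8, x_4x_8\}$. Let $G$ be a clique expansion of $G_7$, and assume that every proper induced subgraph $G'$ of $G$ satisfies $\chi(G')\le \lceil\frac{5}{4}\omega(G')\rceil$. Then $\chi(G)\le \lceil\frac{5}{4}\omega(G)\rceil$.
   Context: A clique expansion of a graph $H$ is any graph $G$ whose vertex set can be partitioned into $|V(H)|$ non-empty cliques $Q_v$, $v\in V(H)$, such that every vertex of $Q_u$ is adjacent to every vertex of $Q_v$ whenever $uv\in E(H)$, and no vertex of $Q_u$ is adjacent to any vertex of $Q_v$ whenever $u\neq v$ and $uv\notin E(H)$. $\chi$ denotes the chromatic number and $\omega$ the clique number. *)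

theory Defs
  imports Complex_Main "HOL-Library.Disjoint_Sets"
    "Graph_Theory.Pair_Digraph" "Graph_Theory.Digraph_Component"
begin

text \<open>
  A finite simple undirected graph is a \<^locale>\<open>pair_graph\<close>: a finite, loop-free, symmetric digraph
  without parallel arcs, in which an edge \<open>uv\<close> is the pair of arcs \<open>(u,v)\<close>, \<open>(v,u)\<close>.
\<close>

definition is_clique :: "'a pair_pre_digraph \<Rightarrow> 'a set \<Rightarrow> bool" where
  "is_clique G K \<longleftrightarrow>
     K \<subseteq> pverts G \<and> (\<forall>u\<in>K. \<forall>v\<in>K. u \<noteq> v \<longrightarrow> (u, v) \<in> parcs G)"

definition clique_number :: "'a pair_pre_digraph \<Rightarrow> nat" where
  "clique_number G = Max (card ` {K. is_clique G K})"

definition is_coloring :: "'a pair_pre_digraph \<Rightarrow> nat \<Rightarrow> ('a \<Rightarrow> nat) \<Rightarrow> bool" where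
  "is_coloring G k f \<longleftrightarrow>
     f ` pverts G \<subseteq> {..<k} \<and> (\<forall>(u, v)\<in>parcs G. f u \<noteq> f v)"

definition chromatic_number :: "'a pair_pre_digraph \<Rightarrow> nat" where
  "chromatic_number G = (LEAST k. \<exists>f. is_coloring G k f)"

definition clique_expansion :: "'b pair_pre_digraph \<Rightarrow> 'a pair_pre_digraph \<Rightarrow> bool" where
  "clique_expansion H G \<longleftrightarrow>
     (\<exists>Q :: 'b \<Rightarrow> 'a set.
        (\<Union>v\<in>pverts H. Q v) = pverts G \<and>
        disjoint_family_on Q (pverts H) \<and>
        (\<forall>v\<in>pverts H. Q v \<noteq> {} \<and> is_clique G (Q v)) \<and>
        (\<forall>u\<in>pverts H. \<forall>v\<in>pverts H. (u, v) \<in> parcs H \<longrightarrow>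
           (\<forall>x\<in>Q u. \<forall>y\<in>Q v. (x, y) \<in> parcs G)) \<and>
        (\<forall>u\<in>pverts H. \<forall>v\<in>pverts H. u \<noteq> v \<and> (u, v) \<notin> parcs H \<longrightarrow>
           (\<forall>x\<in>Q u. \<forall>y\<in>Q v. (x, y) \<notin> parcs G)))"

text \<open>The vertex \<open>x\<^sub>i\<close> is the number \<open>i\<close>; \<^const>\<open>symcl\<close> adds the reverse of each listed pair.\<close>

definition G7 :: "nat pair_pre_digraph" where
  "G7 = \<lparr> pverts = {1..8},
          parcs = symcl {(1,2), (1,3), (2,3), (4,5), (4,6), (5,6), (1,4), (2,5), (3,6),
                         (1,7), (5,7), (2,8), (4,8)} \<rparr>"

lemma pair_graph_G7: "pair_graph G7"
  by unfold_locales
    (auto simp: G7_def symcl_def symmetric_def arcs_ends_conv sym_def)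

end

theory Submission
  imports Defs
begin

text \<open>
  In a minimal counterexample, removing vertices that span an \<open>l\<close>-chromatic subgraph cannot lower
  \<open>\<omega>\<close> by \<open>m > 0\<close> unless \<open>5m < 4l\<close>. With \<open>l = m = 1\<close> this says that every stable set misses a maximum
  clique. Testing this on maximal stable sets of \<open>G\<^sub>7\<close> forces the sizes of the eight cliques to be
  \<open>(a, b, a+b, b, a, a+b, a+2b, 2a+b)\<close> with \<open>\<omega> = 2(a+b)\<close>, and then removing the five stable sets
  \<open>{x\<^sub>1,x\<^sub>6,x\<^sub>8}\<close>, \<open>{x\<^sub>2,x\<^sub>6,x\<^sub>7}\<close>, \<open>{x\<^sub>3,x\<^sub>4,x\<^sub>7}\<close>, \<open>{x\<^sub>3,x\<^sub>5,x\<^sub>8}\<close>, \<open>{x\<^sub>7,x\<^sub>8}\<close> lowers \<open>\<omega>\<close> by 4.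
\<close>

section \<open>Cliques, stable sets and colourings\<close>

definition is_stable :: "'a pair_pre_digraph \<Rightarrow> 'a set \<Rightarrow> bool" where
  "is_stable G S \<longleftrightarrow> S \<subseteq> pverts G \<and> (\<forall>u\<in>S. \<forall>v\<in>S. (u, v) \<notin> parcs G)"

lemma is_clique_subset_pverts: "is_clique G K \<Longrightarrow> K \<subseteq> pverts G"
  by (simp add: is_clique_def)

lemma finite_cliques: "finite (pverts G) \<Longrightarrow> finite {K. is_clique G K}"
  by (rule finite_subset[of _ "Pow (pverts G)"]) (auto dest: is_clique_subset_pverts)

lemma clique_number_le_iff:
  assumes "finite (pverts G)"
  shows "clique_number G \<le> n \<longleftrightarrow> (\<forall>K. is_clique G K \<longrightarrow> card K \<le> n)"
proof -
  have "is_clique G {}" by (simp add: is_clique_def)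
  then show ?thesis
    unfolding clique_number_def using finite_cliques[OF assms] by (subst Max_le_iff) auto
qed

lemma chromatic_number_le: "is_coloring G k f \<Longrightarrow> chromatic_number G \<le> k"
  unfolding chromatic_number_def by (rule Least_le) blast

lemma is_coloringI:
  assumes "\<And>v. v \<in> pverts G \<Longrightarrow> f v < k" and "\<And>u v. (u, v) \<in> parcs G \<Longrightarrow> f u \<noteq> f v"
  shows "is_coloring G k f"
  using assms by (auto simp: is_coloring_def)

lemma (in pair_loopfree_digraph) is_coloring_if_inj_on:
  assumes "inj_on f (pverts G)" and "f ` pverts G \<subseteq> {..<k}"
  shows "is_coloring G k f"
proof (rule is_coloringI)
  show "f v < k" if "v \<in> pverts G" for v
    using assms(2) that by blast
  show "f u \<noteq> f v" if "(u, v) \<in> parcs G" for u v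
    using inj_onD[OF assms(1), of u v] in_arcsD1[OF that] in_arcsD2[OF that] no_loops'[OF that]
    by blast
qed

lemma (in pair_digraph) ex_coloring_chromatic_number:
  "\<exists>f. is_coloring G (chromatic_number G) f"
proof -
  obtain f where "bij_betw f (pverts G) {..<card (pverts G)}"
    using ex_bij_betw_finite_nat[OF pair_finite_verts] by (auto simp: atLeast0LessThan)
  then have "is_coloring G (card (pverts G)) f"
    by (intro is_coloring_if_inj_on) (auto simp: bij_betw_def)
  then have "\<exists>k f. is_coloring G k f"
    by blast
  then show ?thesis
    unfolding chromatic_number_def by (rule LeastI_ex)
qed

section \<open>Induced subgraphs\<close>

definition pair_induce_subgraph :: "'a pair_pre_digraph \<Rightarrow> 'a set \<Rightarrow> 'a pair_pre_digraph"
    (infix \<open>\<restriction>\<^sub>p\<close> 67) where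
  "G \<restriction>\<^sub>p A = \<lparr> pverts = A, parcs = {(u, v) \<in> parcs G. u \<in> A \<and> v \<in> A} \<rparr>"

lemma pair_induce_subgraph_simps [simp]:
  "pverts (G \<restriction>\<^sub>p A) = A"
  "parcs (G \<restriction>\<^sub>p A) = {(u, v) \<in> parcs G. u \<in> A \<and> v \<in> A}"
  by (simp_all add: pair_induce_subgraph_def)

lemma with_proj_pair_induce_subgraph: "with_proj (G \<restriction>\<^sub>p A) = with_proj G \<restriction> A"
  by (auto simp: with_proj_def induce_subgraph_def)

context pair_graph
begin

lemma induced_subgraph_pair_induce:
  "A \<subseteq> pverts G \<Longrightarrow> induced_subgraph (with_proj (G \<restriction>\<^sub>p A)) (with_proj G)"
  by (simp add: with_proj_pair_induce_subgraph induced_induce)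

lemma pair_graph_pair_induce:
  assumes "A \<subseteq> pverts G"
  shows "pair_graph (G \<restriction>\<^sub>p A)"
proof
  show "finite (pverts (G \<restriction>\<^sub>p A))"
    using assms pair_finite_verts by (simp add: finite_subset)
  show "finite (parcs (G \<restriction>\<^sub>p A))"
    by (rule finite_subset[OF _ pair_finite_arcs]) auto
  show "symmetric (with_proj (G \<restriction>\<^sub>p A))"
    using pair_sym_arcs by (auto simp: symmetric_def sym_def)
qed (use pair_no_loops in auto)

lemma chromatic_number_le_add:
  assumes "A \<subseteq> pverts G"
  shows "chromatic_number G \<le>
    chromatic_number (G \<restriction>\<^sub>p A) + chromatic_number (G \<restriction>\<^sub>p (pverts G - A))"
    (is "_ \<le> ?k + ?l")
proof -
  interpret inner: pair_graph "G \<restriction>\<^sub>p A"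
    using assms by (rule pair_graph_pair_induce)
  interpret outer: pair_graph "G \<restriction>\<^sub>p (pverts G - A)"
    by (rule pair_graph_pair_induce) blast
  obtain f g where f: "is_coloring (G \<restriction>\<^sub>p A) ?k f"
    and g: "is_coloring (G \<restriction>\<^sub>p (pverts G - A)) ?l g"
    using inner.ex_coloring_chromatic_number outer.ex_coloring_chromatic_number by blast
  define h where "h x = (if x \<in> A then f x else ?k + g x)" for x
  have f_less: "f x < ?k" if "x \<in> A" for x
    using f that by (auto simp: is_coloring_def)
  have "is_coloring G (?k + ?l) h"
  proof (rule is_coloringI)
    show "h x < ?k + ?l" if "x \<in> pverts G" for x
      using that g f_less[of x] by (auto simp: h_def is_coloring_def image_subset_iff)
    show "h u \<noteq> h v" if "(u, v) \<in> parcs G" for u v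
      using that f g f_less[of u] f_less[of v] in_arcsD1[OF that] in_arcsD2[OF that]
      by (auto simp: h_def is_coloring_def)
  qed
  then show ?thesis
    by (rule chromatic_number_le)
qed

end

section \<open>Minimal counterexamples to a linear bound on the chromatic number\<close>

definition chi_bounded :: "real \<Rightarrow> 'a pair_pre_digraph \<Rightarrow> bool" where
  "chi_bounded c G \<longleftrightarrow> int (chromatic_number G) \<le> \<lceil>c * real (clique_number G)\<rceil>"

definition minimal_counterexample :: "real \<Rightarrow> 'a pair_pre_digraph \<Rightarrow> bool" where
  "minimal_counterexample c G \<longleftrightarrow> \<not> chi_bounded c G \<and>
     (\<forall>G'. induced_subgraph (with_proj G') (with_proj G) \<and> G' \<noteq> G \<longrightarrow> chi_bounded c G')"

lemma (in pair_graph) minimal_counterexample_less_chromatic_number_removed: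
  assumes min: "minimal_counterexample c G"
    and R: "R \<subseteq> pverts G"
    and drop: "clique_number (G \<restriction>\<^sub>p (pverts G - R)) + m \<le> clique_number G"
    and "0 < m"
  shows "c * real m < real (chromatic_number (G \<restriction>\<^sub>p R))"
proof (rule ccontr)
  let ?G' = "G \<restriction>\<^sub>p (pverts G - R)"
  assume "\<not> ?thesis"
  then have chi_R: "real (chromatic_number (G \<restriction>\<^sub>p R)) \<le> c * real m" by simp
  then have "0 \<le> c * real m" by linarith
  then have "0 \<le> c"
    using \<open>0 < m\<close> by (simp add: zero_le_mult_iff)
  have "?G' \<noteq> G"
    using drop \<open>0 < m\<close> by auto
  then have "chi_bounded c ?G'"
    using min induced_subgraph_pair_induce[of "pverts G - R"]
    by (auto simp: minimal_counterexample_def)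
  then have "int (chromatic_number G) \<le>
      int (chromatic_number (G \<restriction>\<^sub>p R)) + \<lceil>c * real (clique_number ?G')\<rceil>"
    using chromatic_number_le_add[OF R] by (simp add: chi_bounded_def)
  also have "\<dots> = \<lceil>real (chromatic_number (G \<restriction>\<^sub>p R)) + c * real (clique_number ?G')\<rceil>"
    by linarith
  also have "\<dots> \<le> \<lceil>c * real (clique_number ?G' + m)\<rceil>"
    using chi_R by (intro ceiling_mono) (simp add: distrib_left)
  also have "\<dots> \<le> \<lceil>c * real (clique_number G)\<rceil>"
    using drop \<open>0 \<le> c\<close> by (intro ceiling_mono mult_left_mono) auto
  finally show False
    using min by (simp add: minimal_counterexample_def chi_bounded_def)
qed

section \<open>Clique expansions\<close>

text \<open>Unlike in \<^const>\<open>clique_expansion\<close>, parts may be empty, so that induced subgraphs inherit the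
  structure.\<close>

locale weak_clique_expansion = pair_graph G for G :: "'a pair_pre_digraph" +
  fixes H :: "'b pair_pre_digraph" and Q :: "'b \<Rightarrow> 'a set"
  assumes finite_pverts_H: "finite (pverts H)"
    and Union_Q: "(\<Union>v\<in>pverts H. Q v) = pverts G"
    and disjoint_Q: "disjoint_family_on Q (pverts H)"
    and clique_Q: "v \<in> pverts H \<Longrightarrow> is_clique G (Q v)"
    and adjacent_iff: "\<lbrakk>u \<in> pverts H; v \<in> pverts H; u \<noteq> v; x \<in> Q u; y \<in> Q v\<rbrakk> \<Longrightarrow>
      (x, y) \<in> parcs G \<longleftrightarrow> (u, v) \<in> parcs H"
begin

lemma finite_Q: "v \<in> pverts H \<Longrightarrow> finite (Q v)"
  using pair_finite_verts unfolding Union_Q[symmetric] by (rule finite_subset[rotated]) blast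

lemma part_unique: "\<lbrakk>x \<in> Q u; x \<in> Q v; u \<in> pverts H; v \<in> pverts H\<rbrakk> \<Longrightarrow> u = v"
  using disjoint_Q unfolding disjoint_family_on_def by blast

lemma weak_clique_expansion_pair_induce:
  assumes "A \<subseteq> pverts G"
  shows "weak_clique_expansion (G \<restriction>\<^sub>p A) H (\<lambda>v. Q v \<inter> A)"
proof -
  interpret A: pair_graph "G \<restriction>\<^sub>p A"
    using assms by (rule pair_graph_pair_induce)
  show ?thesis
  proof
    show "finite (pverts H)" by (rule finite_pverts_H)
    show "(\<Union>v\<in>pverts H. Q v \<inter> A) = pverts (G \<restriction>\<^sub>p A)"
      using assms unfolding Union_Q[symmetric] by auto
    show "disjoint_family_on (\<lambda>v. Q v \<inter> A) (pverts H)"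
      using disjoint_Q unfolding disjoint_family_on_def by blast
    show "is_clique (G \<restriction>\<^sub>p A) (Q v \<inter> A)" if "v \<in> pverts H" for v
      using clique_Q[OF that] by (auto simp: is_clique_def)
    show "(x, y) \<in> parcs (G \<restriction>\<^sub>p A) \<longleftrightarrow> (u, v) \<in> parcs H"
      if "u \<in> pverts H" "v \<in> pverts H" "u \<noteq> v" "x \<in> Q u \<inter> A" "y \<in> Q v \<inter> A" for u v x y
      using that by (simp add: adjacent_iff)
  qed
qed

lemma card_Union_Q: "M \<subseteq> pverts H \<Longrightarrow> card (\<Union>v\<in>M. Q v) = (\<Sum>v\<in>M. card (Q v))"
  using finite_subset[OF _ finite_pverts_H] finite_Q part_unique
  by (intro card_UN_disjoint) blast+

lemma is_clique_Union_Q: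
  assumes "is_clique H M"
  shows "is_clique G (\<Union>v\<in>M. Q v)"
  unfolding is_clique_def
proof (intro conjI ballI impI)
  have M: "M \<subseteq> pverts H"
    using assms by (rule is_clique_subset_pverts)
  then show "(\<Union>v\<in>M. Q v) \<subseteq> pverts G"
    using Union_Q by blast
  fix x y assume "x \<in> (\<Union>v\<in>M. Q v)" "y \<in> (\<Union>v\<in>M. Q v)" "x \<noteq> y"
  then obtain u v where uv: "u \<in> M" "v \<in> M" "x \<in> Q u" "y \<in> Q v" by blast
  show "(x, y) \<in> parcs G"
  proof (cases "u = v")
    case True
    then show ?thesis
      using uv M \<open>x \<noteq> y\<close> clique_Q[of u] by (auto simp: is_clique_def)
  next
    case False
    then show ?thesis
      using uv M assms adjacent_iff[of u v x y] by (auto simp: is_clique_def)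
  qed
qed

lemma is_clique_parts_met:
  assumes "is_clique G K"
  shows "is_clique H {v \<in> pverts H. Q v \<inter> K \<noteq> {}}"
  unfolding is_clique_def
proof (intro conjI ballI impI)
  fix u v
  assume "u \<in> {v \<in> pverts H. Q v \<inter> K \<noteq> {}}" "v \<in> {v \<in> pverts H. Q v \<inter> K \<noteq> {}}" "u \<noteq> v"
  then obtain x y where xy: "u \<in> pverts H" "x \<in> Q u" "x \<in> K" "v \<in> pverts H" "y \<in> Q v" "y \<in> K"
    by auto
  then have "x \<noteq> y"
    using part_unique[of x u v] \<open>u \<noteq> v\<close> by blast
  then have "(x, y) \<in> parcs G"
    using assms xy by (auto simp: is_clique_def)
  then show "(u, v) \<in> parcs H"
    using xy \<open>u \<noteq> v\<close> adjacent_iff[of u v x y] by blast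
qed auto

lemma clique_number_le_iff_sum:
  "clique_number G \<le> n \<longleftrightarrow> (\<forall>M. is_clique H M \<longrightarrow> (\<Sum>v\<in>M. card (Q v)) \<le> n)"
  unfolding clique_number_le_iff[OF pair_finite_verts]
proof (intro iffI allI impI)
  fix M assume "\<forall>K. is_clique G K \<longrightarrow> card K \<le> n" "is_clique H M"
  then show "(\<Sum>v\<in>M. card (Q v)) \<le> n"
    using is_clique_Union_Q[of M] card_Union_Q[OF is_clique_subset_pverts, of M] by metis
next
  fix K assume bound: "\<forall>M. is_clique H M \<longrightarrow> (\<Sum>v\<in>M. card (Q v)) \<le> n" and K: "is_clique G K"
  define M where "M = {v \<in> pverts H. Q v \<inter> K \<noteq> {}}"
  have M: "is_clique H M"
    unfolding M_def using K by (rule is_clique_parts_met)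
  have "finite (\<Union>v\<in>M. Q v)"
    using finite_pverts_H finite_Q by (simp add: M_def)
  moreover have "K \<subseteq> (\<Union>v\<in>M. Q v)"
    using is_clique_subset_pverts[OF K] Union_Q unfolding M_def by blast
  ultimately have "card K \<le> card (\<Union>v\<in>M. Q v)"
    by (rule card_mono)
  then show "card K \<le> n"
    using bound[rule_format, OF M] card_Union_Q[OF is_clique_subset_pverts[OF M]] by linarith
qed

lemma sum_card_le_clique_number: "is_clique H M \<Longrightarrow> (\<Sum>v\<in>M. card (Q v)) \<le> clique_number G"
  using clique_number_le_iff_sum by blast

lemma clique_number_pair_induce_Diff_le:
  assumes "\<And>M. is_clique H M \<Longrightarrow> (\<Sum>v\<in>M. card (Q v) - card (Q v \<inter> R)) \<le> n"
  shows "clique_number (G \<restriction>\<^sub>p (pverts G - R)) \<le> n"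
proof -
  interpret rest: weak_clique_expansion "G \<restriction>\<^sub>p (pverts G - R)" H "\<lambda>v. Q v \<inter> (pverts G - R)"
    by (rule weak_clique_expansion_pair_induce) blast
  have card_rest: "card (Q v \<inter> (pverts G - R)) = card (Q v) - card (Q v \<inter> R)"
    if v: "v \<in> pverts H" for v
  proof -
    have "Q v \<inter> (pverts G - R) = Q v - Q v \<inter> R"
      using v Union_Q by blast
    then show ?thesis
      using finite_Q[OF v] by (simp add: card_Diff_subset)
  qed
  have "(\<Sum>v\<in>M. card (Q v \<inter> (pverts G - R))) \<le> n" if M: "is_clique H M" for M
  proof -
    have "(\<Sum>v\<in>M. card (Q v \<inter> (pverts G - R))) = (\<Sum>v\<in>M. card (Q v) - card (Q v \<inter> R))"
      using card_rest is_clique_subset_pverts[OF M] by (intro sum.cong) auto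
    with assms[OF M] show ?thesis by simp
  qed
  then show ?thesis
    by (simp add: rest.clique_number_le_iff_sum)
qed

end

section \<open>Removing a list of stable sets\<close>

lemma disjoint_family_obtain_glued:
  assumes "disjoint_family_on A I"
  obtains f where "\<And>i x. i \<in> I \<Longrightarrow> x \<in> A i \<Longrightarrow> f x = g i x"
proof
  fix i x assume "i \<in> I" "x \<in> A i"
  then have "(THE j. j \<in> I \<and> x \<in> A j) = i"
    using disjoint_family_onD[OF assms, of _ i] by (intro the_equality) blast+
  then show "g (THE j. j \<in> I \<and> x \<in> A j) x = g i x"
    by simp
qed

definition cover_count :: "'b set list \<Rightarrow> 'b \<Rightarrow> nat" where
  "cover_count Ss v = length (filter (\<lambda>S. v \<in> S) Ss)"

context weak_clique_expansion
begin

lemma is_coloring_pair_induce_if_stable: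
  assumes R: "R \<subseteq> pverts G"
    and stable: "\<And>S. S \<in> set Ss \<Longrightarrow> is_stable H S"
    and inj: "\<And>v. v \<in> pverts H \<Longrightarrow> inj_on f (Q v \<inter> R)"
    and colors: "\<And>v x. v \<in> pverts H \<Longrightarrow> x \<in> Q v \<inter> R \<Longrightarrow> f x < length Ss \<and> v \<in> Ss ! f x"
  shows "is_coloring (G \<restriction>\<^sub>p R) (length Ss) f"
proof (rule is_coloringI)
  have in_part: "\<exists>v\<in>pverts H. x \<in> Q v \<inter> R" if "x \<in> R" for x
    using that R Union_Q by blast
  then show "f x < length Ss" if "x \<in> pverts (G \<restriction>\<^sub>p R)" for x
    using that colors by fastforce
  fix x y assume "(x, y) \<in> parcs (G \<restriction>\<^sub>p R)"
  then have xy: "(x, y) \<in> parcs G" "x \<in> R" "y \<in> R" by auto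
  obtain u v where uv: "u \<in> pverts H" "v \<in> pverts H" "x \<in> Q u \<inter> R" "y \<in> Q v \<inter> R"
    using in_part xy(2,3) by blast
  show "f x \<noteq> f y"
  proof (cases "u = v")
    case True
    then show ?thesis
      using inj_onD[OF inj[OF uv(2)]] uv(3,4) no_loops'[OF xy(1)] by blast
  next
    case False
    then have "(u, v) \<in> parcs H"
      using uv xy(1) adjacent_iff[of u v x y] by blast
    then have "\<not> (u \<in> S \<and> v \<in> S)" if "S \<in> set Ss" for S
      using stable[OF that] by (auto simp: is_stable_def)
    then show ?thesis
      using colors[OF uv(1,3)] colors[OF uv(2,4)] by (metis nth_mem)
  qed
qed

lemma obtain_colorable_transversal:
  assumes stable: "\<And>S. S \<in> set Ss \<Longrightarrow> is_stable H S"
    and count: "\<And>v. v \<in> pverts H \<Longrightarrow> cover_count Ss v \<le> card (Q v)"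
  obtains R where "R \<subseteq> pverts G" "\<And>v. v \<in> pverts H \<Longrightarrow> card (Q v \<inter> R) = cover_count Ss v"
    "chromatic_number (G \<restriction>\<^sub>p R) \<le> length Ss"
proof -
  define I where "I v = {i. i < length Ss \<and> v \<in> Ss ! i}" for v
  have "\<exists>A g. A \<subseteq> Q v \<and> card A = cover_count Ss v \<and> bij_betw g A (I v)"
    if v: "v \<in> pverts H" for v
  proof -
    obtain A where A: "A \<subseteq> Q v" "card A = cover_count Ss v" "finite A"
      using count[OF v] by (rule obtain_subset_with_card_n)
    moreover have "card (I v) = cover_count Ss v"
      by (simp add: I_def cover_count_def length_filter_conv_card)
    ultimately show ?thesis
      using finite_same_card_bij[of A "I v"] by (auto simp: I_def)
  qed
  then obtain A g where A: "A v \<subseteq> Q v" "card (A v) = cover_count Ss v"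
    and g: "bij_betw (g v) (A v) (I v)" if "v \<in> pverts H" for v
    by metis
  define R where "R = (\<Union>v\<in>pverts H. A v)"
  have R: "R \<subseteq> pverts G"
    using A(1) Union_Q unfolding R_def by blast
  have Q_Int_R: "Q v \<inter> R = A v" if "v \<in> pverts H" for v
    using A(1) that part_unique unfolding R_def by blast
  obtain f where f: "f x = g v x" if "v \<in> pverts H" "x \<in> Q v" for v x
    using disjoint_family_obtain_glued[OF disjoint_Q, of g] by blast
  have "is_coloring (G \<restriction>\<^sub>p R) (length Ss) f"
  proof (rule is_coloring_pair_induce_if_stable[OF R stable])
    show "inj_on f (Q v \<inter> R)" if "v \<in> pverts H" for v
      using bij_betw_imp_inj_on[OF g[OF that]] f[OF that] A(1)[OF that] unfolding Q_Int_R[OF that]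
      by (metis inj_on_cong subsetD)
    show "f x < length Ss \<and> v \<in> Ss ! f x" if "v \<in> pverts H" "x \<in> Q v \<inter> R" for v x
      using bij_betw_apply[OF g[OF that(1)], of x] f[OF that(1)] that(2)
      by (simp add: Q_Int_R[OF that(1), symmetric] I_def)
  qed
  then have "chromatic_number (G \<restriction>\<^sub>p R) \<le> length Ss"
    by (rule chromatic_number_le)
  moreover have "card (Q v \<inter> R) = cover_count Ss v" if "v \<in> pverts H" for v
    using A(2)[OF that] Q_Int_R[OF that] by simp
  ultimately show thesis
    using R that by blast
qed

lemma minimal_counterexample_less_length_stable_sets:
  assumes min: "minimal_counterexample c G"
    and stable: "\<And>S. S \<in> set Ss \<Longrightarrow> is_stable H S"
    and count: "\<And>v. v \<in> pverts H \<Longrightarrow> cover_count Ss v \<le> card (Q v)"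
    and drop: "\<And>M. is_clique H M \<Longrightarrow>
      (\<Sum>v\<in>M. card (Q v) - cover_count Ss v) + m \<le> clique_number G"
    and "0 < m"
  shows "c * real m < real (length Ss)"
proof -
  obtain R where R: "R \<subseteq> pverts G" "\<And>v. v \<in> pverts H \<Longrightarrow> card (Q v \<inter> R) = cover_count Ss v"
    and chi_R: "chromatic_number (G \<restriction>\<^sub>p R) \<le> length Ss"
    using obtain_colorable_transversal[OF stable count] by blast
  have "(\<Sum>v\<in>M. card (Q v) - card (Q v \<inter> R)) \<le> clique_number G - m" if M: "is_clique H M" for M
  proof -
    have "(\<Sum>v\<in>M. card (Q v) - card (Q v \<inter> R)) = (\<Sum>v\<in>M. card (Q v) - cover_count Ss v)"
      using R(2) is_clique_subset_pverts[OF M] by (intro sum.cong) auto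
    then show ?thesis
      using drop[OF M] by linarith
  qed
  then have "clique_number (G \<restriction>\<^sub>p (pverts G - R)) \<le> clique_number G - m"
    by (rule clique_number_pair_induce_Diff_le)
  moreover have "m \<le> clique_number G"
    using drop[of "{}"] by (simp add: is_clique_def)
  ultimately have "c * real m < real (chromatic_number (G \<restriction>\<^sub>p R))"
    using min R(1) \<open>0 < m\<close>
    by (intro minimal_counterexample_less_chromatic_number_removed) linarith+
  then show ?thesis
    using chi_R by linarith
qed

end

locale nonempty_clique_expansion = weak_clique_expansion +
  assumes nonempty_Q: "v \<in> pverts H \<Longrightarrow> Q v \<noteq> {}"
begin

lemma card_Q_pos: "v \<in> pverts H \<Longrightarrow> 0 < card (Q v)"
  using nonempty_Q finite_Q by (simp add: card_gt_0_iff)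

lemma maximum_weight_clique_maximal:
  assumes N: "is_clique H N" and "M \<subseteq> N" and "(\<Sum>v\<in>M. card (Q v)) = clique_number G"
  shows "M = N"
proof (rule ccontr)
  assume "M \<noteq> N"
  then obtain v where v: "v \<in> N - M"
    using \<open>M \<subseteq> N\<close> by blast
  have "N \<subseteq> pverts H"
    using N by (rule is_clique_subset_pverts)
  then have "(\<Sum>v\<in>M. card (Q v)) < (\<Sum>v\<in>N. card (Q v))"
    using v \<open>M \<subseteq> N\<close> card_Q_pos finite_subset[OF _ finite_pverts_H]
    by (intro sum_strict_mono2[of N M v]) auto
  then show False
    using assms(3) sum_card_le_clique_number[OF N] by simp
qed

lemma minimal_counterexample_stable_avoids_maximum_clique:
  assumes min: "minimal_counterexample c G" and "1 \<le> c" and S: "is_stable H S"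
  shows "\<exists>M. is_clique H M \<and> M \<inter> S = {} \<and> (\<Sum>v\<in>M. card (Q v)) = clique_number G"
proof (rule ccontr)
  assume no_clique: "\<not> ?thesis"
  have count: "cover_count [S] v = (if v \<in> S then 1 else 0)" for v
    by (simp add: cover_count_def)
  have "(\<Sum>v\<in>M. card (Q v) - cover_count [S] v) + 1 \<le> clique_number G"
    if M: "is_clique H M" for M
  proof (cases "M \<inter> S = {}")
    case True
    have "(\<Sum>v\<in>M. card (Q v) - cover_count [S] v) \<le> (\<Sum>v\<in>M. card (Q v))"
      by (rule sum_mono) simp
    moreover have "(\<Sum>v\<in>M. card (Q v)) \<noteq> clique_number G"
      using no_clique M True by blast
    ultimately show ?thesis
      using sum_card_le_clique_number[OF M] by linarith
  next
    case False
    have sub: "M \<subseteq> pverts H"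
      using M by (rule is_clique_subset_pverts)
    with False have "\<exists>v\<in>M. card (Q v) - cover_count [S] v < card (Q v)"
      using card_Q_pos by (fastforce simp: count)
    then have "(\<Sum>v\<in>M. card (Q v) - cover_count [S] v) < (\<Sum>v\<in>M. card (Q v))"
      using finite_subset[OF sub finite_pverts_H] by (intro sum_strict_mono_ex1) auto
    then show ?thesis
      using sum_card_le_clique_number[OF M] by linarith
  qed
  moreover have "cover_count [S] v \<le> card (Q v)" if "v \<in> pverts H" for v
    using card_Q_pos[OF that] by (simp add: count)
  ultimately have "c * real 1 < real (length [S])"
    using min S by (intro minimal_counterexample_less_length_stable_sets) auto
  then show False
    using \<open>1 \<le> c\<close> by simp
qed

end

lemma clique_expansionE:
  assumes "pair_graph G" and "finite (pverts H)" and "clique_expansion H G"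
  obtains Q where "nonempty_clique_expansion G H Q"
proof -
  interpret pair_graph G by fact
  obtain Q where Q: "(\<Union>v\<in>pverts H. Q v) = pverts G" "disjoint_family_on Q (pverts H)"
    and parts: "\<forall>v\<in>pverts H. Q v \<noteq> {} \<and> is_clique G (Q v)"
    and complete: "\<forall>u\<in>pverts H. \<forall>v\<in>pverts H. (u, v) \<in> parcs H \<longrightarrow>
      (\<forall>x\<in>Q u. \<forall>y\<in>Q v. (x, y) \<in> parcs G)"
    and anticomplete: "\<forall>u\<in>pverts H. \<forall>v\<in>pverts H. u \<noteq> v \<and> (u, v) \<notin> parcs H \<longrightarrow>
      (\<forall>x\<in>Q u. \<forall>y\<in>Q v. (x, y) \<notin> parcs G)"
    using assms(3) unfolding clique_expansion_def by (elim exE conjE)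
  have "nonempty_clique_expansion G H Q"
  proof
    show "(x, y) \<in> parcs G \<longleftrightarrow> (u, v) \<in> parcs H"
      if "u \<in> pverts H" "v \<in> pverts H" "u \<noteq> v" "x \<in> Q u" "y \<in> Q v" for u v x y
      using complete anticomplete that by blast
  qed (use Q parts assms(2) in simp_all)
  then show thesis by (rule that)
qed

section \<open>The graph \<open>G\<^sub>7\<close>\<close>

definition G7_max_cliques :: "nat set set" where
  "G7_max_cliques =
     {{1,2,3}, {4,5,6}, {1,4}, {2,5}, {3,6}, {1,7}, {5,7}, {2,8}, {4,8}}"

lemma pverts_G7: "pverts G7 = {1,2,3,4,5,6,7,8}"
  by (auto simp: G7_def)

lemma is_clique_G7_max: "M \<in> G7_max_cliques \<Longrightarrow> is_clique G7 M"
  unfolding G7_max_cliques_def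
  by (elim insertE emptyE) (simp_all add: is_clique_def G7_def symcl_def)

lemma is_clique_G7_subset_max:
  assumes "is_clique G7 M"
  shows "\<exists>N\<in>G7_max_cliques. M \<subseteq> N"
proof -
  have not_both: "u \<notin> M \<or> v \<notin> M" if "u \<noteq> v" "(u, v) \<notin> parcs G7" for u v
    using assms that by (auto simp: is_clique_def)
  have nonadjacent: "\<forall>(u, v)\<in>{(1,5), (1,6), (1,8), (2,4), (2,6), (2,7), (3,4), (3,5), (3,7), (3,8),
      (4,7), (5,8), (6,7), (6,8), (7,8)}. u \<notin> M \<or> v \<notin> M"
    unfolding ball_simps case_prod_conv
    by (intro conjI TrueI; rule not_both; simp add: G7_def symcl_def)
  have "\<exists>N\<in>G7_max_cliques. \<forall>v\<in>pverts G7. v \<in> M \<longrightarrow> v \<in> N"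
    unfolding G7_max_cliques_def pverts_G7
    by (simp del: One_nat_def) (insert nonadjacent[unfolded ball_simps case_prod_conv], argo)
  moreover have "M \<subseteq> pverts G7"
    using assms by (rule is_clique_subset_pverts)
  ultimately show ?thesis
    by blast
qed

definition G7_extremal :: "(nat \<Rightarrow> nat) \<Rightarrow> nat \<Rightarrow> bool" where
  "G7_extremal q w \<longleftrightarrow>
     0 < q 1 \<and> 0 < q 2 \<and> q 3 = q 1 + q 2 \<and> q 4 = q 2 \<and> q 5 = q 1 \<and> q 6 = q 1 + q 2 \<and>
     q 7 = q 1 + 2 * q 2 \<and> q 8 = 2 * q 1 + q 2 \<and> w = 2 * (q 1 + q 2)"

lemma is_stable_G7:
  assumes "S \<in> {{1,5,8}, {1,6,8}, {2,6,7}, {3,4,7}, {3,5,8}, {3,7,8}, {6,7,8}, {7,8}}"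
  shows "is_stable G7 S"
  using assms by (elim insertE emptyE) (simp_all add: is_stable_def G7_def symcl_def)

lemma G7_extremalI:
  assumes pos: "\<And>v. v \<in> pverts G7 \<Longrightarrow> 0 < q v"
    and bound: "\<And>M. is_clique G7 M \<Longrightarrow> sum q M \<le> w"
    and tight: "\<And>S. is_stable G7 S \<Longrightarrow> \<exists>M\<in>G7_max_cliques. M \<inter> S = {} \<and> sum q M = w"
  shows "G7_extremal q w"
proof -
  have pos_all: "\<forall>v\<in>{1,2,3,4,5,6,7,8}. 0 < q v"
    using pos by (simp add: pverts_G7)
  have "\<forall>M\<in>G7_max_cliques. sum q M \<le> w"
    using bound is_clique_G7_max by blast
  then have sum_le: "q 1 + q 2 + q 3 \<le> w" "q 4 + q 5 + q 6 \<le> w" "q 1 + q 4 \<le> w" "q 2 + q 5 \<le> w"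
    "q 1 + q 7 \<le> w" "q 5 + q 7 \<le> w" "q 2 + q 8 \<le> w" "q 4 + q 8 \<le> w"
    by (simp_all add: G7_max_cliques_def add.assoc)
  note tight_avoiding = tight[OF is_stable_G7, unfolded G7_max_cliques_def]
  have "q 3 + q 6 = w"
    using tight_avoiding[of "{1,5,8}"] by simp
  moreover from this have "q 1 + q 4 \<noteq> w" "q 2 + q 5 \<noteq> w"
    using sum_le pos_all by auto
  moreover from this have "q 5 + q 7 = w" "q 4 + q 8 = w" "q 2 + q 8 = w" "q 1 + q 7 = w"
    "q 4 + q 5 + q 6 = w" "q 1 + q 2 + q 3 = w"
    using tight_avoiding[of "{1,6,8}"] tight_avoiding[of "{2,6,7}"] tight_avoiding[of "{3,4,7}"]
      tight_avoiding[of "{3,5,8}"] tight_avoiding[of "{3,7,8}"] tight_avoiding[of "{6,7,8}"]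
    by (simp_all add: add.assoc)
  ultimately show ?thesis
    using pos_all unfolding G7_extremal_def by simp
qed

lemma minimal_counterexample_G7_extremal:
  assumes "nonempty_clique_expansion G G7 Q" and min: "minimal_counterexample c G" and "1 \<le> c"
  shows "G7_extremal (\<lambda>v. card (Q v)) (clique_number G)"
proof -
  interpret nonempty_clique_expansion G G7 Q by fact
  show ?thesis
  proof (rule G7_extremalI)
    fix S assume "is_stable G7 S"
    then obtain M where M: "is_clique G7 M" "M \<inter> S = {}" "(\<Sum>v\<in>M. card (Q v)) = clique_number G"
      using minimal_counterexample_stable_avoids_maximum_clique[OF min \<open>1 \<le> c\<close>] by blast
    then obtain N where N: "N \<in> G7_max_cliques" "M \<subseteq> N"
      using is_clique_G7_subset_max by blast
    then have "M = N"
      using M(3) is_clique_G7_max by (intro maximum_weight_clique_maximal)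
    with M N(1) show "\<exists>M\<in>G7_max_cliques. M \<inter> S = {} \<and> (\<Sum>v\<in>M. card (Q v)) = clique_number G"
      by blast
  qed (use card_Q_pos sum_card_le_clique_number in auto)
qed

definition G7_stable_sets :: "nat set list" where
  "G7_stable_sets = [{1,6,8}, {2,6,7}, {3,4,7}, {3,5,8}, {7,8}]"

lemma cover_count_G7_stable_sets_le:
  assumes "G7_extremal q w" and "v \<in> pverts G7"
  shows "cover_count G7_stable_sets v \<le> q v"
  using assms by (auto simp: cover_count_def G7_stable_sets_def G7_extremal_def pverts_G7)

lemma G7_extremal_sum_diff_cover_count_le:
  assumes extremal: "G7_extremal q w" and M: "is_clique G7 M"
  shows "(\<Sum>v\<in>M. q v - cover_count G7_stable_sets v) + 4 \<le> w"
proof -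
  obtain N where N: "N \<in> G7_max_cliques" "M \<subseteq> N"
    using is_clique_G7_subset_max[OF M] by blast
  have "finite N"
    using N(1) by (auto simp: G7_max_cliques_def)
  then have "(\<Sum>v\<in>M. q v - cover_count G7_stable_sets v)
      \<le> (\<Sum>v\<in>N. q v - cover_count G7_stable_sets v)"
    using N(2) by (intro sum_mono2) auto
  also have "\<dots> + 4 \<le> w"
    using N(1) extremal unfolding G7_max_cliques_def
    by (elim insertE emptyE)
      (simp_all add: cover_count_def G7_stable_sets_def G7_extremal_def)
  finally show ?thesis by simp
qed

theorem theorem8:
  fixes G :: "'a pair_pre_digraph"
  assumes "pair_graph G"
    and "clique_expansion G7 G"
    and "\<And>G' :: 'a pair_pre_digraph.
           induced_subgraph (with_proj G') (with_proj G) \<Longrightarrow> G' \<noteq> G \<Longrightarrow>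
           int (chromatic_number G') \<le> \<lceil>5 / 4 * real (clique_number G')\<rceil>"
  shows "int (chromatic_number G) \<le> \<lceil>5 / 4 * real (clique_number G)\<rceil>"
proof (rule ccontr)
  assume "\<not> ?thesis"
  then have min: "minimal_counterexample (5 / 4) G"
    using assms(3) by (simp add: minimal_counterexample_def chi_bounded_def)
  obtain Q where "nonempty_clique_expansion G G7 Q"
    using clique_expansionE[OF assms(1) _ assms(2)] by (auto simp: pverts_G7)
  then interpret nonempty_clique_expansion G G7 Q .
  have extremal: "G7_extremal (\<lambda>v. card (Q v)) (clique_number G)"
    using nonempty_clique_expansion_axioms min by (rule minimal_counterexample_G7_extremal) simp
  have "5 / 4 * real 4 < real (length G7_stable_sets)"
  proof (rule minimal_counterexample_less_length_stable_sets[OF min])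
    show "is_stable G7 S" if "S \<in> set G7_stable_sets" for S
      using that unfolding G7_stable_sets_def list.set
      by (elim insertE emptyE; intro is_stable_G7; simp)
  qed (use extremal cover_count_G7_stable_sets_le G7_extremal_sum_diff_cover_count_le in auto)
  then show False
    by (simp add: G7_stable_sets_def)
qed

end
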